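(* Let $\ell$ be a positive integer and $0<m\le n$ integers. The number $D[\ell]_{n,m}$ is $0$ unless $m\equiv n \pmod \ell$, in which case $$D[\ell]_{n,m}=\frac{1}{n+1}\binom{m-1+(n-m)/\ell}{m-1}\binom{n+m}{m}.$$
   Context: A dissection of a convex polygon with labelled vertices is a set of pairwise non-crossing diagonals, partitioning the polygon into sub-polygons (cells). A dissection is $\ell$-periodic if each cell has $3+\ell d$ vertices for some integer $d\ge0$. $D[\ell]_{n,m}$ is the number of $\ell$-periodic dissections of a fixed convex $(n+2)$-gon with exactly $m$ cells. *)

theory Defs
  imports Complex_Main "HOL-Number_Theory.Cong"
begin

text \<open>
  A convex polygon with labelled vertices is represented by its finite vertex set
  \<open>V :: nat set\<close>, the cyclic order of the vertices being the one induced by the order of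
  the labels. Subsets of \<open>V\<close> with at least three elements are then exactly the sub-polygons
  spanned by vertices of the polygon.
\<close>

definition sides :: "nat set \<Rightarrow> nat set set" where
  "sides V = {{a, b} | a b. a \<in> V \<and> b \<in> V \<and> a < b \<and>
      ((\<forall>v\<in>V. \<not> (a < v \<and> v < b)) \<or> (\<forall>v\<in>V. a \<le> v \<and> v \<le> b))}"

definition diagonals :: "nat set \<Rightarrow> nat set set" where
  "diagonals V = {{a, b} | a b. a \<in> V \<and> b \<in> V \<and> a < b} - sides V"

definition crossing :: "nat set \<Rightarrow> nat set \<Rightarrow> bool" where
  "crossing e f \<longleftrightarrow> (\<exists>a b c d. {e, f} = {{a, b}, {c, d}} \<and> a < c \<and> c < b \<and> b < d)"

definition dissection :: "nat set \<Rightarrow> nat set set \<Rightarrow> bool" where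
  "dissection V D \<longleftrightarrow> D \<subseteq> diagonals V \<and> (\<forall>e\<in>D. \<forall>f\<in>D. \<not> crossing e f)"

text \<open>
  A cell is a sub-polygon bounded by sides of the polygon and diagonals of the dissection
  that is not subdivided further. For the latter it suffices that no diagonal of the
  dissection is a diagonal of the cell: any other segment between vertices of \<open>V\<close> that meets
  the interior of the cell crosses one of the bounding sides of the cell.
\<close>

definition cells :: "nat set \<Rightarrow> nat set set \<Rightarrow> nat set set" where
  "cells V D = {C. C \<subseteq> V \<and> 3 \<le> card C \<and> sides C \<subseteq> sides V \<union> D \<and> diagonals C \<inter> D = {}}"

definition periodic_dissection :: "nat \<Rightarrow> nat set \<Rightarrow> nat set set \<Rightarrow> bool" where
  "periodic_dissection l V D \<longleftrightarrow>
     dissection V D \<and> (\<forall>C\<in>cells V D. \<exists>d::nat. card C = 3 + l * d)"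

definition num_periodic_dissections :: "nat \<Rightarrow> nat \<Rightarrow> nat \<Rightarrow> nat" where
  "num_periodic_dissections l n m =
     card {D. periodic_dissection l {0..<n + 2} D \<and> card (cells {0..<n + 2} D) = m}"

end

theory Submission
  imports Defs "HOL-Computational_Algebra.Formal_Power_Series"
begin

text \<open>
  Adding the base edge \<open>(0, n + 1)\<close> to a dissection gives a noncrossing set of arcs whose members
  correspond to the cells: an arc is the base of the cell directly below it. Over a segment of
  \<open>n\<close> unit steps, such arc systems are ordered forests with \<open>n\<close> leaves and one internal node per
  arc; \<open>k + 1\<close> vertices not covered by any arc mean \<open>k\<close> trees.
  Removing the first leaf, or the root of the first tree, gives
  \<open>F(k, n, m) = F(k - 1, n - 1, m) + \<Sum>p\<in>S. F(k + p, n, m - 1)\<close>, where a cell with \<open>p + 2\<close> vertices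
  is allowed if \<open>p \<in> S\<close>. This recursion is solved by
  \<open>(n + m) F(k, n, m) = k (n + m choose m) [X\<^sup>n\<^sup>-\<^sup>k] P\<^sup>m\<close> with \<open>P = \<Sum>p\<in>S. X\<^sup>p\<close>; the weighted sum in the
  induction step comes from \<open>X (P\<^sup>m)' = m (X P') P\<^sup>m\<^sup>-\<^sup>1\<close>. For \<open>S = {1 + l d}\<close> we have
  \<open>P (1 - X\<^sup>l) = X\<close>, which yields the coefficients of \<open>P\<^sup>m\<close>.
\<close>

section \<open>Noncrossing arc systems\<close>

text \<open>The bound \<open>a + 2 \<le> b\<close> excludes the unit steps, which are sides of the
  polygon.\<close>

definition arcs :: "nat \<Rightarrow> nat \<Rightarrow> (nat \<times> nat) set" where
  "arcs s N = {(a, b). s \<le> a \<and> a + 2 \<le> b \<and> b \<le> N}"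

definition noncrossing :: "(nat \<times> nat) set \<Rightarrow> bool" where
  "noncrossing A \<longleftrightarrow> (\<forall>a b c d. (a, b) \<in> A \<longrightarrow> (c, d) \<in> A \<longrightarrow> \<not> (a < c \<and> c < b \<and> b < d))"

definition visible :: "(nat \<times> nat) set \<Rightarrow> nat \<Rightarrow> nat \<Rightarrow> nat set" where
  "visible A s N = {v \<in> {s..N}. \<forall>c d. (c, d) \<in> A \<longrightarrow> \<not> (c < v \<and> v < d)}"

definition inside :: "(nat \<times> nat) set \<Rightarrow> nat \<Rightarrow> nat \<Rightarrow> (nat \<times> nat) set" where
  "inside A a b = {(c, d) \<in> A. a \<le> c \<and> d \<le> b \<and> (c, d) \<noteq> (a, b)}"

text \<open>These are the vertices of the cell directly below the arc \<open>(a, b)\<close>. The arc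
  itself is left out of \<open>inside\<close>, since it would hide its own cell.\<close>

definition face :: "(nat \<times> nat) set \<Rightarrow> nat \<Rightarrow> nat \<Rightarrow> nat set" where
  "face A a b = visible (inside A a b) a b"

text \<open>The parameter \<open>p\<close> is the number of trees gained when a root is deleted: a
  cell with \<open>p + 2\<close> vertices has \<open>p + 1\<close> edges besides its base, so one
  tree becomes \<open>p + 1\<close> trees.\<close>

definition systems :: "nat set \<Rightarrow> nat \<Rightarrow> nat \<Rightarrow> nat \<Rightarrow> nat \<Rightarrow> (nat \<times> nat) set set" where
  "systems S s N k m = {A. A \<subseteq> arcs s N \<and> noncrossing A \<and>
     (\<forall>a b. (a, b) \<in> A \<longrightarrow> (\<exists>p\<in>S. card (face A a b) = p + 2)) \<and>
     card A = m \<and> card (visible A s N) = k + 1}"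

lemma finite_arcs: "finite (arcs s N)"
  by (rule finite_subset[of _ "{..N} \<times> {..N}"]) (auto simp: arcs_def)

lemma finite_visible [simp]: "finite (visible A s N)"
  by (simp add: visible_def)

lemma finite_systems: "finite (systems S s N k m)"
  by (rule finite_subset[of _ "Pow (arcs s N)"]) (auto simp: systems_def finite_arcs)

lemma visible_antimono: "A \<subseteq> B \<Longrightarrow> visible B s N \<subseteq> visible A s N"
  by (auto simp: visible_def)

lemma card_visible_le: "card (visible A s N) \<le> Suc N - s"
proof -
  have "card (visible A s N) \<le> card {s..N}"
    by (rule card_mono) (auto simp: visible_def)
  then show ?thesis by simp
qed

lemma endpoints_visible:
  assumes "A \<subseteq> arcs s N" "s \<le> N"
  shows "s \<in> visible A s N" "N \<in> visible A s N"
  using assms by (fastforce simp: visible_def arcs_def)+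

lemma inside_subset_arcs: "A \<subseteq> arcs s N \<Longrightarrow> inside A a b \<subseteq> arcs a b"
  by (fastforce simp: inside_def arcs_def)

lemma noncrossing_subset: "noncrossing B \<Longrightarrow> A \<subseteq> B \<Longrightarrow> noncrossing A"
  unfolding noncrossing_def by blast

lemma noncrossing_inside: "noncrossing A \<Longrightarrow> noncrossing (inside A a b)"
  by (erule noncrossing_subset) (auto simp: inside_def)

text \<open>An arc covering the end \<open>d\<close> of the longest arc from \<open>p\<close> starts
  at or before \<open>p\<close>, as it would otherwise cross \<open>(p, d)\<close>. Starting before
  \<open>p\<close> would hide \<open>p\<close>, and starting at \<open>p\<close> contradicts
  maximality.\<close>

lemma longest_arc_visible:
  assumes A: "A \<subseteq> arcs s N" "noncrossing A" and p: "p \<in> visible A s N" and pd: "(p, d0) \<in> A"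
  obtains d where "(p, d) \<in> A" "d \<in> visible A s N" "\<And>d'. (p, d') \<in> A \<Longrightarrow> d' \<le> d"
proof -
  let ?E = "{d. (p, d) \<in> A}"
  have fin: "finite ?E"
    by (rule finite_subset[of _ "{..N}"]) (use A in \<open>auto simp: arcs_def\<close>)
  define d where "d = Max ?E"
  have d: "(p, d) \<in> A"
    using Max_in[OF fin] pd unfolding d_def by blast
  have mx: "d' \<le> d" if "(p, d') \<in> A" for d'
    using Max_ge[OF fin] that unfolding d_def by simp
  have "d \<in> visible A s N"
    unfolding visible_def
  proof (intro CollectI conjI allI impI notI)
    show "d \<in> {s..N}" using d A by (auto simp: arcs_def)
  next
    fix c e assume ce: "(c, e) \<in> A" "c < d \<and> d < e"
    have "c \<le> p" using ce d A(2) unfolding noncrossing_def by (meson not_le)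
    moreover have "p < d" using d A(1) by (auto simp: arcs_def)
    ultimately have "c = p" using p ce by (fastforce simp: visible_def)
    then show False using mx ce by fastforce
  qed
  then show thesis using that d mx by blast
qed

text \<open>If \<open>p + 1\<close> is hidden, the arc over it starts at \<open>p\<close>, because
  \<open>p\<close> is visible. The longest arc from \<open>p\<close> ends at a visible vertex, which
  is not before \<open>q\<close> by the gap and not after \<open>q\<close> because \<open>q\<close>
  is visible.\<close>

lemma consecutive_visible:
  assumes A: "A \<subseteq> arcs s N" "noncrossing A"
    and p: "p \<in> visible A s N" and q: "q \<in> visible A s N" "p < q"
    and gap: "\<And>v. v \<in> visible A s N \<Longrightarrow> \<not> (p < v \<and> v < q)"
  shows "q = p + 1 \<or> (p, q) \<in> A"
proof (rule disjCI)
  assume npq: "(p, q) \<notin> A"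
  show "q = p + 1"
  proof (rule ccontr)
    assume "q \<noteq> p + 1"
    with q have "p + 1 < q" by simp
    with gap[of "p + 1"] have "p + 1 \<notin> visible A s N" by auto
    moreover have "p + 1 \<in> {s..N}" using p q by (auto simp: visible_def)
    ultimately obtain c d where cd: "(c, d) \<in> A" "c < p + 1" "p + 1 < d"
      by (auto simp: visible_def)
    have "c = p" using p cd by (fastforce simp: visible_def)
    with cd have "(p, d) \<in> A" by simp
    from longest_arc_visible[OF A p this] obtain d where
      d: "(p, d) \<in> A" "d \<in> visible A s N" by blast
    have "p < d" using d A by (auto simp: arcs_def)
    then have "q \<le> d" using gap d by (meson not_le)
    moreover have "\<not> q < d" using q d by (auto simp: visible_def)
    ultimately show False using d npq by simp
  qed
qed

section \<open>Adding an arc that starts at the leftmost vertex\<close>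

lemma visible_insert:
  assumes "A \<subseteq> arcs s N" "b \<in> visible A s N" "s < b"
  shows "visible (insert (s, b) A) s N = insert s (visible A s N \<inter> {b..})"
  using assms by (fastforce simp: visible_def arcs_def)

text \<open>Since \<open>b\<close> is visible, an arc ending after \<open>b\<close> starts at
  \<open>b\<close> or later and hides nothing up to \<open>b\<close>. So only the arcs below
  \<open>(s, b)\<close> matter there.\<close>

lemma face_insert_self:
  assumes "A \<subseteq> arcs s N" "b \<in> visible A s N" "(s, b) \<notin> A"
  shows "face (insert (s, b) A) s b = visible A s N \<inter> {..b}"
proof -
  have "inside (insert (s, b) A) s b = {(c, d) \<in> A. d \<le> b}"
    using assms by (auto simp: inside_def arcs_def)
  moreover have "visible {(c, d) \<in> A. d \<le> b} s b = visible A s N \<inter> {..b}"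
  proof (intro equalityI subsetI)
    fix v assume v: "v \<in> visible {(c, d) \<in> A. d \<le> b} s b"
    have "\<not> (c < v \<and> v < d)" if "(c, d) \<in> A" for c d
    proof (cases "d \<le> b")
      case True then show ?thesis using v that by (auto simp: visible_def)
    next
      case False
      have "\<not> c < b" using False assms(2) that unfolding visible_def not_le by blast
      then show ?thesis using v by (auto simp: visible_def)
    qed
    then show "v \<in> visible A s N \<inter> {..b}"
      using v assms(2) by (auto simp: visible_def)
  qed (auto simp: visible_def)
  ultimately show ?thesis by (simp add: face_def)
qed

text \<open>The new arc could lie below \<open>(c, d)\<close> only if \<open>c = s\<close> and
  \<open>b < d\<close>, and then \<open>(c, d)\<close> would hide \<open>b\<close>.\<close>

lemma face_insert_other:
  assumes "A \<subseteq> arcs s N" "b \<in> visible A s N" "(s, b) \<notin> A" "s < b" "(c, d) \<in> A"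
  shows "face (insert (s, b) A) c d = face A c d"
proof -
  have "inside (insert (s, b) A) c d = inside A c d"
    using assms by (fastforce simp: inside_def arcs_def visible_def)
  then show ?thesis by (simp add: face_def)
qed

lemma noncrossing_insert:
  assumes "A \<subseteq> arcs s N" "b \<in> visible A s N" "noncrossing A"
  shows "noncrossing (insert (s, b) A)"
  using assms unfolding noncrossing_def by (fastforce simp: arcs_def visible_def)

section \<open>Ranks in finite sets of naturals\<close>

lemma card_split_at:
  fixes V :: "nat set"
  assumes "finite V" "b \<in> V"
  shows "card (V \<inter> {..b}) + card (V \<inter> {b..}) = card V + 1"
proof -
  have "(V \<inter> {..b}) \<union> (V \<inter> {b..}) = V" by auto
  moreover have "(V \<inter> {..b}) \<inter> (V \<inter> {b..}) = {b}" using assms by auto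
  ultimately show ?thesis
    using card_Un_Int[of "V \<inter> {..b}" "V \<inter> {b..}"] assms by simp
qed

text \<open>Supplies the right end of a new arc that is to close off a prescribed number of visible
  vertices.\<close>

lemma ex_element_of_rank:
  fixes V :: "nat set"
  assumes "finite V" "0 < i" "i \<le> card V"
  shows "\<exists>u\<in>V. card (V \<inter> {..u}) = i"
  using assms
proof (induction "card V" arbitrary: V)
  case 0
  then show ?case by simp
next
  case (Suc r)
  then have ne: "V \<noteq> {}" by auto
  let ?M = "Max V"
  have M: "?M \<in> V" using Suc ne by simp
  show ?case
  proof (cases "i = Suc r")
    case True
    have "V \<inter> {..?M} = V" using Suc by auto
    then show ?thesis using True M Suc by metis
  next
    case False
    have c: "card (V - {?M}) = r" using Suc M by simp
    obtain u where u: "u \<in> V - {?M}" "card ((V - {?M}) \<inter> {..u}) = i"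
      using Suc.hyps(1)[of "V - {?M}"] c Suc False by auto
    have "u < ?M" using u Suc by (simp add: le_neq_implies_less)
    then have "(V - {?M}) \<inter> {..u} = V \<inter> {..u}" by auto
    then show ?thesis using u by auto
  qed
qed

text \<open>The rank is strictly increasing on \<open>V\<close>, so a vertex found by its rank is
  unique.\<close>

lemma rank_inj:
  fixes V :: "nat set"
  assumes "finite V" "u \<in> V" "v \<in> V" "card (V \<inter> {..u}) = card (V \<inter> {..v})"
  shows "u = v"
proof -
  have *: "card (V \<inter> {..x}) < card (V \<inter> {..y})" if "x < y" "y \<in> V" for x y
  proof (rule psubset_card_mono)
    show "V \<inter> {..x} \<subset> V \<inter> {..y}" using that by force
  qed (simp add: assms)
  show ?thesis using * assms by (metis less_irrefl linorder_neqE_nat)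
qed

text \<open>Of two arcs from \<open>s\<close>, the longer one hides the end of the shorter
  one.\<close>

lemma visible_arc_unique:
  assumes "A \<subseteq> arcs s N" "(s, b) \<in> A" "(s, c) \<in> A" "b \<in> visible A s N" "c \<in> visible A s N"
  shows "b = c"
proof -
  have "s < b" "s < c" using assms by (auto simp: arcs_def)
  then have "\<not> b < c" "\<not> c < b" using assms unfolding visible_def by blast+
  then show ?thesis by simp
qed

section \<open>Counting arc systems\<close>

lemma systems_memD:
  assumes "A \<in> systems S s N k m"
  shows "A \<subseteq> arcs s N" "noncrossing A" "card A = m" "card (visible A s N) = k + 1" "finite A"
    "\<And>a b. (a, b) \<in> A \<Longrightarrow> \<exists>p\<in>S. card (face A a b) = p + 2"
  using assms finite_subset[OF _ finite_arcs, of A s N] by (simp_all add: systems_def)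

text \<open>Without an arc at \<open>s\<close>, the first tree is the single leaf from
  \<open>s\<close> to \<open>s + 1\<close>. Dropping it costs the visible vertex \<open>s\<close>
  and leaves all arcs and faces as they are.\<close>

lemma systems_no_first_arc:
  assumes "s < N"
  shows "{A \<in> systems S s N (Suc k) m. \<forall>b. (s, b) \<notin> A} = systems S (Suc s) N k m"
proof -
  have arcs: "A \<subseteq> arcs s N \<and> (\<forall>b. (s, b) \<notin> A) \<longleftrightarrow> A \<subseteq> arcs (Suc s) N" for A
    unfolding arcs_def subset_iff by (auto simp: Suc_le_eq) (metis le_less)+
  have "card (visible A s N) = Suc (card (visible A (Suc s) N))" if "A \<subseteq> arcs (Suc s) N" for A
  proof -
    have "visible A s N = insert s (visible A (Suc s) N)"
    proof (intro equalityI subsetI)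
      fix v assume "v \<in> visible A s N"
      then show "v \<in> insert s (visible A (Suc s) N)" by (auto simp: visible_def)
    next
      fix v assume "v \<in> insert s (visible A (Suc s) N)"
      then show "v \<in> visible A s N"
        using that assms by (fastforce simp: visible_def arcs_def)
    qed
    moreover have "s \<notin> visible A (Suc s) N" by (auto simp: visible_def)
    ultimately show ?thesis by simp
  qed
  note card_visible = this
  show ?thesis
  proof (intro equalityI subsetI)
    fix A assume A: "A \<in> {A \<in> systems S s N (Suc k) m. \<forall>b. (s, b) \<notin> A}"
    then have "A \<subseteq> arcs (Suc s) N" using arcs[of A] by (simp add: systems_def)
    then show "A \<in> systems S (Suc s) N k m"
      using A card_visible[of A] by (simp add: systems_def)
  next
    fix A assume A: "A \<in> systems S (Suc s) N k m"
    then have "A \<subseteq> arcs (Suc s) N" by (simp add: systems_def)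
    then show "A \<in> {A \<in> systems S s N (Suc k) m. \<forall>b. (s, b) \<notin> A}"
      using A card_visible[of A] arcs[of A] by (simp add: systems_def)
  qed
qed

text \<open>An arc from \<open>s\<close> with visible right end is the root of the first tree, so
  \<open>p\<close> records the size of that root's cell.\<close>

definition systems_first_face ::
    "nat set \<Rightarrow> nat \<Rightarrow> nat \<Rightarrow> nat \<Rightarrow> nat \<Rightarrow> nat \<Rightarrow> (nat \<times> nat) set set" where
  "systems_first_face S s N k m p = {A \<in> systems S s N k m.
     \<exists>b. (s, b) \<in> A \<and> b \<in> visible A s N \<and> card (face A s b) = p + 2}"

text \<open>Deleting the root of the first tree is inverse to joining \<open>s\<close> to the
  visible vertex of rank \<open>p + 2\<close>. The new arc hides the \<open>p\<close> vertices
  strictly between, which takes the number of trees from \<open>Suc k + p\<close> to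
  \<open>Suc k\<close>.\<close>

lemma card_systems_first_face:
  assumes "p \<in> S" "0 \<notin> S"
  shows "card (systems_first_face S s N (Suc k) (Suc m) p) = card (systems S s N (Suc k + p) m)"
proof -
  define u where "u A = (SOME b. b \<in> visible A s N \<and> card (visible A s N \<inter> {..b}) = p + 2)" for A
  have p: "0 < p" using assms by (metis gr0I)
  have u: "u A \<in> visible A s N" "card (visible A s N \<inter> {..u A}) = p + 2" "s < u A"
      "(s, u A) \<notin> A" "(s, u A) \<in> arcs s N"
    if A: "A \<in> systems S s N (Suc k + p) m" for A
  proof -
    let ?V = "visible A s N"
    have "\<exists>b\<in>?V. card (?V \<inter> {..b}) = p + 2"
      by (rule ex_element_of_rank) (use systems_memD(4)[OF A] in auto)
    then show u: "u A \<in> ?V" "card (?V \<inter> {..u A}) = p + 2"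
      unfolding u_def by (metis (mono_tags, lifting) someI)+
    \<comment> \<open>As \<open>p > 0\<close>, there are at least three visible vertices up to
      \<open>u A\<close>, hence one strictly between \<open>s\<close> and \<open>u A\<close>. It
      makes the new pair long enough for an arc and shows that the arc is not yet present.\<close>
    have "\<not> ?V \<inter> {..u A} \<subseteq> {s, u A}"
    proof
      assume "?V \<inter> {..u A} \<subseteq> {s, u A}"
      then have "card (?V \<inter> {..u A}) \<le> card {s, u A}" by (rule card_mono[rotated]) simp
      also have "\<dots> \<le> 2" by (simp add: card_insert_if)
      finally show False using u p by simp
    qed
    then obtain v where v: "v \<in> ?V" "v \<le> u A" "v \<noteq> s" "v \<noteq> u A" by auto
    then have v: "v \<in> ?V" "s < v" "v < u A" by (auto simp: visible_def)
    then show "s < u A" by simp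
    show "(s, u A) \<notin> A" using v by (auto simp: visible_def)
    show "(s, u A) \<in> arcs s N" using v u(1) by (auto simp: arcs_def visible_def)
  qed
  let ?g = "\<lambda>A. insert (s, u A) A"
  have "bij_betw ?g (systems S s N (Suc k + p) m) (systems_first_face S s N (Suc k) (Suc m) p)"
    unfolding bij_betw_def
  proof
    show "inj_on ?g (systems S s N (Suc k + p) m)"
    proof (rule inj_onI)
      fix A B
      assume A: "A \<in> systems S s N (Suc k + p) m" and B: "B \<in> systems S s N (Suc k + p) m"
        and eq: "?g A = ?g B"
      \<comment> \<open>Otherwise the arc \<open>(s, u B)\<close> already belongs to
        \<open>A\<close> and hides \<open>u A\<close>, which is visible in \<open>A\<close>.\<close>
      have "\<not> u A < u B"
      proof
        assume "u A < u B"
        then have "(s, u B) \<in> A" using eq by (metis insertCI insertE less_irrefl prod.inject)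
        then show False using u(1,3)[OF A] \<open>u A < u B\<close> by (auto simp: visible_def)
      qed
      moreover have "\<not> u B < u A"
      proof
        assume "u B < u A"
        then have "(s, u A) \<in> B" using eq by (metis insertCI insertE less_irrefl prod.inject)
        then show False using u(1,3)[OF B] \<open>u B < u A\<close> by (auto simp: visible_def)
      qed
      ultimately have "u A = u B" by simp
      then show "A = B" using eq u(4)[OF A] u(4)[OF B] by (metis insert_ident)
    qed
    show "?g ` systems S s N (Suc k + p) m = systems_first_face S s N (Suc k) (Suc m) p"
    proof (intro equalityI subsetI)
      fix B assume "B \<in> ?g ` systems S s N (Suc k + p) m"
      then obtain A where A: "A \<in> systems S s N (Suc k + p) m" and B: "B = insert (s, u A) A"
        by blast
      note mA = systems_memD[OF A] and uA = u[OF A]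
      have f1: "card (face B s (u A)) = p + 2"
        using face_insert_self[OF mA(1) uA(1) uA(4)] uA(2) B by simp
      have f2: "face B a b = face A a b" if "(a, b) \<in> A" for a b
        using face_insert_other[OF mA(1) uA(1) uA(4) uA(3) that] B by simp
      have V: "visible B s N = insert s (visible A s N \<inter> {u A..})"
        using visible_insert[OF mA(1) uA(1) uA(3)] B by simp
      have "card (visible B s N) = Suc (card (visible A s N \<inter> {u A..}))"
        using uA(3) unfolding V by (subst card_insert_disjoint) auto
      then have "card (visible B s N) = Suc k + 1"
        using card_split_at[OF finite_visible uA(1)] uA(2) mA(4) by simp
      moreover have "noncrossing B"
        using noncrossing_insert[OF mA(1) uA(1) mA(2)] B by simp
      moreover have "card B = Suc m" using mA uA(4) B by simp
      moreover have "\<exists>p\<in>S. card (face B a b) = p + 2" if "(a, b) \<in> B" for a b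
        using that f1 f2 mA(6) B assms(1) by auto
      moreover have "u A \<in> visible B s N" using V uA(1) by simp
      ultimately show "B \<in> systems_first_face S s N (Suc k) (Suc m) p"
        using f1 mA(1) uA(5) B by (auto simp: systems_first_face_def systems_def)
    next
      fix B assume "B \<in> systems_first_face S s N (Suc k) (Suc m) p"
      then obtain b where B: "B \<in> systems S s N (Suc k) (Suc m)" and
        b: "(s, b) \<in> B" "b \<in> visible B s N" "card (face B s b) = p + 2"
        by (auto simp: systems_first_face_def)
      note mB = systems_memD[OF B]
      define A where "A = B - {(s, b)}"
      have BA: "B = insert (s, b) A" and nb: "(s, b) \<notin> A" using b A_def by auto
      have sub: "A \<subseteq> arcs s N" and nc: "noncrossing A"
        using mB noncrossing_subset[of B A] by (auto simp: A_def)
      have bA: "b \<in> visible A s N" using b(2) visible_antimono[of A B] A_def by auto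
      have sb: "s < b" using mB(1) b(1) by (auto simp: arcs_def)
      have r: "card (visible A s N \<inter> {..b}) = p + 2"
        using face_insert_self[OF sub bA nb] b(3) BA by simp
      have "card (visible B s N) = Suc (card (visible A s N \<inter> {b..}))"
        using sb unfolding BA visible_insert[OF sub bA sb] by (subst card_insert_disjoint) auto
      then have "card (visible A s N) = Suc k + p + 1"
        using card_split_at[OF finite_visible bA] r mB(4) by simp
      moreover have "card A = m" using mB b A_def by simp
      moreover have "\<exists>p\<in>S. card (face A a c) = p + 2" if "(a, c) \<in> A" for a c
        using mB(6)[of a c] that face_insert_other[OF sub bA nb sb that] BA by simp
      ultimately have A: "A \<in> systems S s N (Suc k + p) m"
        using sub nc by (simp add: systems_def)
      \<comment> \<open>The end of the deleted arc has rank \<open>p + 2\<close> among the remaining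
        visible vertices, which identifies it with the chosen end.\<close>
      have "u A = b"
        by (rule rank_inj[OF finite_visible u(1)[OF A] bA]) (simp add: u(2)[OF A] r)
      then show "B \<in> ?g ` systems S s N (Suc k + p) m" using A BA by blast
    qed
  qed
  then show ?thesis by (simp add: bij_betw_same_card)
qed

text \<open>The first root is the longest arc from \<open>s\<close>. Its cell fits into
  \<open>{s..N}\<close>, which bounds \<open>p\<close> and makes the index set finite even for
  infinite \<open>S\<close>.\<close>

lemma systems_first_arc:
  assumes "s \<le> N"
  shows "{A \<in> systems S s N k m. \<exists>b. (s, b) \<in> A} =
    (\<Union>p\<in>S \<inter> {..N - s}. systems_first_face S s N k m p)"
proof (intro equalityI subsetI)
  fix A assume "A \<in> {A \<in> systems S s N k m. \<exists>b. (s, b) \<in> A}"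
  then obtain b0 where A: "A \<in> systems S s N k m" and b0: "(s, b0) \<in> A" by blast
  note mA = systems_memD[OF A]
  obtain b where b: "(s, b) \<in> A" "b \<in> visible A s N"
    using longest_arc_visible[OF mA(1,2) endpoints_visible(1)[OF mA(1) assms] b0] by blast
  obtain p where p: "p \<in> S" "card (face A s b) = p + 2" using mA(6)[OF b(1)] by blast
  have "b \<le> N" using b(2) by (simp add: visible_def)
  then have "p \<le> N - s"
    using card_visible_le[of "inside A s b" s b] p(2) by (simp add: face_def)
  then show "A \<in> (\<Union>p\<in>S \<inter> {..N - s}. systems_first_face S s N k m p)"
    using A b p by (auto simp: systems_first_face_def)
qed (auto simp: systems_first_face_def)

lemma systems_first_face_disjoint:
  assumes "p \<noteq> q"
  shows "systems_first_face S s N k m p \<inter> systems_first_face S s N k m q = {}"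
proof (rule equals0I)
  fix A assume "A \<in> systems_first_face S s N k m p \<inter> systems_first_face S s N k m q"
  then obtain b c where "A \<in> systems S s N k m"
    and b: "(s, b) \<in> A" "b \<in> visible A s N" "card (face A s b) = p + 2"
    and c: "(s, c) \<in> A" "c \<in> visible A s N" "card (face A s c) = q + 2"
    unfolding systems_first_face_def by blast
  then have "b = c" using visible_arc_unique[OF systems_memD(1)] by simp
  then show False using b c assms by simp
qed

lemma card_systems_rec:
  assumes "s < N" "0 \<notin> S"
  shows "card (systems S s N (Suc k) (Suc m)) = card (systems S (Suc s) N k (Suc m)) +
    (\<Sum>p\<in>S \<inter> {..N - s}. card (systems S s N (Suc k + p) m))"
proof -
  let ?X = "systems S s N (Suc k) (Suc m)"
  have "card ?X = card {A \<in> ?X. \<forall>b. (s, b) \<notin> A} + card {A \<in> ?X. \<exists>b. (s, b) \<in> A}"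
    by (subst card_Un_disjoint[symmetric])
       (auto intro!: arg_cong[where f = card] simp: finite_systems)
  moreover have "card (\<Union>p\<in>S \<inter> {..N - s}. systems_first_face S s N (Suc k) (Suc m) p) =
      (\<Sum>p\<in>S \<inter> {..N - s}. card (systems S s N (Suc k + p) m))"
  proof (subst card_UN_disjoint)
    show "\<forall>p\<in>S \<inter> {..N - s}. finite (systems_first_face S s N (Suc k) (Suc m) p)"
      by (simp add: systems_first_face_def finite_systems)
  qed (auto simp: systems_first_face_disjoint card_systems_first_face assms(2))
  ultimately show ?thesis
    using assms by (simp add: systems_no_first_arc systems_first_arc)
qed

text \<open>A forest without internal nodes has exactly as many trees as leaves.\<close>

lemma systems_no_arcs:
  assumes "s + n = N"
  shows "card (systems S s N k 0) = of_bool (k = n)"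
proof -
  have "visible {} s N = {s..N}" by (auto simp: visible_def)
  then have "systems S s N k 0 = (if k = n then {{}} else {})"
    using assms finite_subset[OF _ finite_arcs] by (auto simp: systems_def noncrossing_def)
  then show ?thesis by simp
qed

lemma systems_gt_empty:
  assumes "N - s < k" "s \<le> N"
  shows "systems S s N k m = {}"
proof -
  have "card (visible A s N) \<noteq> k + 1" for A
    using card_visible_le[of A s N] assms by simp
  then show ?thesis by (simp add: systems_def)
qed

lemma systems_0_empty:
  assumes "s < N"
  shows "systems S s N 0 m = {}"
proof -
  have "card (visible A s N) \<noteq> 1" if "A \<subseteq> arcs s N" for A
    using endpoints_visible[OF that] assms by (auto simp: card_1_singleton_iff)
  then show ?thesis by (auto simp: systems_def)
qed

lemma systems_trivial_empty: "systems S N N k (Suc m) = {}"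
proof -
  have "arcs N N = {}" by (auto simp: arcs_def)
  then show ?thesis by (auto simp: systems_def)
qed

section \<open>Solving the recursion with power series\<close>

unbundle fps_syntax

definition parts_fps :: "nat set \<Rightarrow> real fps" where
  "parts_fps S = Abs_fps (\<lambda>p. of_bool (p \<in> S))"

text \<open>Compare the coefficients at \<open>j\<close> in
  \<open>X (P ^ Suc m)' = Suc m * (X P') * P ^ m\<close>; the operator \<open>X d/dX\<close>
  multiplies the coefficient at \<open>p\<close> by \<open>p\<close>.\<close>

lemma sum_parts_weighted:
  "real (Suc m) * (\<Sum>p\<in>S \<inter> {..j}. real p * (parts_fps S ^ m $ (j - p))) =
   real j * (parts_fps S ^ Suc m $ j)"
proof -
  let ?P = "parts_fps S"
  have "(fps_X * fps_deriv (?P ^ Suc m)) $ j = real j * (?P ^ Suc m $ j)"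
    by (cases j) (simp_all del: power_Suc fps_deriv_mult)
  moreover have "fps_X * fps_deriv (?P ^ Suc m) =
      fps_const (real (Suc m)) * ((fps_X * fps_deriv ?P) * ?P ^ m)"
    by (subst fps_deriv_power) (simp add: mult_ac)
  moreover have "((fps_X * fps_deriv ?P) * ?P ^ m) $ j =
      (\<Sum>p\<in>S \<inter> {..j}. real p * (?P ^ m $ (j - p)))"
  proof -
    have "(fps_X * fps_deriv ?P) $ p = real p * of_bool (p \<in> S)" for p
      by (cases p) (auto simp: parts_fps_def)
    then have "((fps_X * fps_deriv ?P) * ?P ^ m) $ j =
        (\<Sum>p\<in>{0..j}. real p * of_bool (p \<in> S) * (?P ^ m $ (j - p)))"
      by (simp add: fps_mult_nth)
    also have "\<dots> = (\<Sum>p\<in>S \<inter> {..j}. real p * of_bool (p \<in> S) * (?P ^ m $ (j - p)))"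
      by (rule sum.mono_neutral_right) auto
    finally show ?thesis by simp
  qed
  ultimately show ?thesis by (metis fps_mult_left_const_nth)
qed

lemma sum_parts:
  "(\<Sum>p\<in>S \<inter> {..j}. parts_fps S ^ m $ (j - p)) = parts_fps S ^ Suc m $ j"
proof -
  have "parts_fps S ^ Suc m $ j = (\<Sum>p\<in>{0..j}. of_bool (p \<in> S) * (parts_fps S ^ m $ (j - p)))"
    by (simp add: fps_mult_nth parts_fps_def)
  also have "\<dots> = (\<Sum>p\<in>S \<inter> {..j}. of_bool (p \<in> S) * (parts_fps S ^ m $ (j - p)))"
    by (rule sum.mono_neutral_right) auto
  finally show ?thesis by simp
qed

text \<open>Absorption identities that bring the binomials of both terms of the recursion to the
  common value \<open>(n + Suc m) choose Suc m\<close>.\<close>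

lemma binomial_absorb_real:
  "real (n + Suc m) * real ((n + m) choose m) = real (Suc m) * real ((n + Suc m) choose Suc m)"
  "real (n + Suc m) * real ((n + m) choose Suc m) = real n * real ((n + Suc m) choose Suc m)"
proof -
  show 1: "real (n + Suc m) * real ((n + m) choose m) = real (Suc m) * real ((n + Suc m) choose Suc m)"
    using Suc_times_binomial_eq[of "n + m" m]
    by (metis add_Suc_right mult.commute of_nat_mult)
  have "(n + Suc m) choose Suc m = ((n + m) choose m) + ((n + m) choose Suc m)" by simp
  then show "real (n + Suc m) * real ((n + m) choose Suc m) = real n * real ((n + Suc m) choose Suc m)"
    using 1 by (simp add: algebra_simps)
qed

text \<open>The factor \<open>n + m\<close> stays on the left, so no division occurs. The outer
  induction on \<open>m\<close> handles removing a root, the inner one on \<open>n\<close> removing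
  a leaf.\<close>

theorem card_systems:
  assumes "0 \<notin> S" "s + n = N" "k \<le> n"
  shows "real (n + m) * real (card (systems S s N k m)) =
    real k * real ((n + m) choose m) * (parts_fps S ^ m $ (n - k))"
  using assms(2,3)
proof (induction m arbitrary: s n k)
  case 0
  then show ?case by (auto simp: systems_no_arcs)
next
  case (Suc m)
  note IHm = Suc.IH
  from Suc.prems show ?case
  proof (induction n arbitrary: s k)
    case 0
    then show ?case by (simp add: systems_trivial_empty)
  next
    case (Suc n)
    show ?case
    proof (cases k)
      case 0
      then show ?thesis using Suc.prems by (simp add: systems_0_empty)
    next
      case k: (Suc k')
      \<comment> \<open>Removing a leaf lowers the numbers of leaves and trees together, so
        \<open>j\<close> is the coefficient index both before and after.\<close>
      define j where "j = n - k'"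
      define W where "W = parts_fps S ^ Suc m $ j"
      define c where "c = real ((Suc n + Suc m) choose Suc m)"
      have n: "n = k' + j" using Suc.prems k j_def by simp
      have j: "Suc n - k = j" using k j_def by simp
      have sN: "s < N" "N - s = Suc n" using Suc.prems by auto
      have F1: "real (n + Suc m) * real (card (systems S (Suc s) N k' (Suc m))) =
          real k' * real ((n + Suc m) choose Suc m) * W"
        using Suc.IH[of "Suc s" k'] Suc.prems k j_def W_def by simp
      \<comment> \<open>For \<open>p > j\<close> there would be more trees than leaves, so these
        terms vanish.\<close>
      have "(\<Sum>p\<in>S \<inter> {..Suc n}. card (systems S s N (k + p) m)) =
          (\<Sum>p\<in>S \<inter> {..j}. card (systems S s N (k + p) m))"
        by (rule sum.mono_neutral_right) (use n k sN in \<open>auto simp: systems_gt_empty not_le card_gt_0_iff\<close>)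
      then have rec: "card (systems S s N k (Suc m)) = card (systems S (Suc s) N k' (Suc m)) +
          (\<Sum>p\<in>S \<inter> {..j}. card (systems S s N (k + p) m))"
        using card_systems_rec[OF sN(1) assms(1), of k' m] k sN(2) by simp
      have "real (Suc n + m) * real (\<Sum>p\<in>S \<inter> {..j}. card (systems S s N (k + p) m)) =
          (\<Sum>p\<in>S \<inter> {..j}. real (Suc n + m) * real (card (systems S s N (k + p) m)))"
        by (simp add: sum_distrib_left)
      also have "\<dots> = (\<Sum>p\<in>S \<inter> {..j}. real (k + p) * real ((Suc n + m) choose m) *
          (parts_fps S ^ m $ (j - p)))"
      proof (rule sum.cong)
        fix p assume "p \<in> S \<inter> {..j}"
        then have "k + p \<le> Suc n" "Suc n - (k + p) = j - p" using n k by auto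
        then show "real (Suc n + m) * real (card (systems S s N (k + p) m)) =
            real (k + p) * real ((Suc n + m) choose m) * (parts_fps S ^ m $ (j - p))"
          using IHm[of s "Suc n" "k + p"] Suc.prems by simp
      qed simp
      also have "\<dots> = real ((Suc n + m) choose m) *
          (real k * (\<Sum>p\<in>S \<inter> {..j}. parts_fps S ^ m $ (j - p)) +
           (\<Sum>p\<in>S \<inter> {..j}. real p * (parts_fps S ^ m $ (j - p))))"
        by (simp add: sum_distrib_left sum.distrib algebra_simps)
      also have "\<dots> = real ((Suc n + m) choose m) * (real k * W +
           (\<Sum>p\<in>S \<inter> {..j}. real p * (parts_fps S ^ m $ (j - p))))"
        by (simp only: sum_parts W_def)
      finally have "real (Suc n + m) * real (\<Sum>p\<in>S \<inter> {..j}. card (systems S s N (k + p) m)) =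
          real ((Suc n + m) choose m) * (real k * W +
           (\<Sum>p\<in>S \<inter> {..j}. real p * (parts_fps S ^ m $ (j - p))))" .
      moreover have "M * x = c * (M * a + j') * W"
        if "x = c * (a * W + y)" "M * y = j' * W" for M x c a y j' :: real
      proof -
        have "M * x = c * (M * a * W + M * y)" using that(1) by (simp add: algebra_simps)
        then show ?thesis unfolding that(2) by (simp add: algebra_simps)
      qed
      ultimately have F2: "real (Suc m) * (real (Suc n + m) *
            real (\<Sum>p\<in>S \<inter> {..j}. card (systems S s N (k + p) m))) =
          real ((Suc n + m) choose m) * (real (Suc m) * real k + real j) * W"
        using sum_parts_weighted[of m S j] unfolding W_def by blast
      have b: "real (Suc n + Suc m) * real ((Suc n + m) choose m) = real (Suc m) * c"
        "real (Suc n + Suc m) * real ((n + Suc m) choose Suc m) = real (Suc n) * c"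
        using binomial_absorb_real[of "Suc n" m] by (simp_all add: c_def)
      let ?F = "real (card (systems S s N k (Suc m)))"
      \<comment> \<open>The recursion is multiplied by every denominator at once:
        \<open>Suc m\<close> from the weighted sum, \<open>Suc n + m\<close> from the induction
        hypotheses, \<open>Suc n + Suc m\<close> from the absorption identities.\<close>
      have "real (Suc m) * real (Suc n + m) * (real (Suc n + Suc m) * ?F) =
          real (Suc m) * real k' * (real (Suc n + Suc m) * real ((n + Suc m) choose Suc m)) * W +
          (real (Suc n + Suc m) * real ((Suc n + m) choose m)) * (real (Suc m) * real k + real j) * W"
      proof -
        have eq: "M * Q * (R * (x + y)) = M * a * (R * d) * W + (R * e) * h * W"
          if "Q * x = a * d * W" "M * (Q * y) = e * h * W" for M Q R x y a d e h :: real
        proof -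
          have "M * Q * (R * (x + y)) = M * R * (Q * x) + R * (M * (Q * y))"
            by (simp add: algebra_simps)
          then show ?thesis unfolding that by (simp add: algebra_simps)
        qed
        have "n + Suc m = Suc n + m" by simp
        then show ?thesis unfolding rec of_nat_add[of "card _"]
          by (intro eq) (use F1 F2 in simp_all)
      qed
      \<comment> \<open>With \<open>n = k' + j\<close> and \<open>k = k' + 1\<close> this is the
        identity \<open>k' * (n + 1) + (m + 1) * k + j = k * (n + 1 + m)\<close>.\<close>
      also have "\<dots> = real (Suc m) * real (Suc n + m) * (real k * c * W)"
        unfolding b by (simp add: n k algebra_simps)
      finally have "real (Suc n + Suc m) * ?F = real k * c * W" by simp
      then show ?thesis unfolding c_def W_def j .
    qed
  qed
qed

section \<open>Coefficients for the periodic cell sizes\<close>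

definition periodic_parts :: "nat \<Rightarrow> nat set" where
  "periodic_parts l = {p. \<exists>d. p = 1 + l * d}"

text \<open>Multiply \<open>P = X ^ l * P + X\<close> by \<open>P ^ m\<close> and compare
  coefficients.\<close>

lemma parts_fps_power_rec:
  assumes "0 < l"
  shows "parts_fps (periodic_parts l) ^ Suc m $ j =
    (if l \<le> j then parts_fps (periodic_parts l) ^ Suc m $ (j - l) else 0) +
    (if j = 0 then 0 else parts_fps (periodic_parts l) ^ m $ (j - 1))"
proof -
  let ?P = "parts_fps (periodic_parts l)"
  have mem: "p \<in> periodic_parts l \<longleftrightarrow> p = 1 \<or> l \<le> p \<and> p - l \<in> periodic_parts l" for p
  proof
    assume "p \<in> periodic_parts l"
    then obtain d where "p = 1 + l * d" by (auto simp: periodic_parts_def)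
    then show "p = 1 \<or> l \<le> p \<and> p - l \<in> periodic_parts l"
      by (cases d) (auto simp: periodic_parts_def)
  next
    assume p: "p = 1 \<or> l \<le> p \<and> p - l \<in> periodic_parts l"
    show "p \<in> periodic_parts l"
    proof (cases "p = 1")
      case True
      then show ?thesis by (auto simp: periodic_parts_def intro: exI[of _ 0])
    next
      case False
      with p obtain d where "l \<le> p" "p - l = 1 + l * d" by (auto simp: periodic_parts_def)
      then have "p = 1 + l * Suc d" by simp
      then show ?thesis unfolding periodic_parts_def by blast
    qed
  qed
  \<comment> \<open>Truncated subtraction gives \<open>1 - l = 0\<close>, so at \<open>p = 1\<close>
    only the summand \<open>X\<close> contributes, also for \<open>l = 1\<close>.\<close>
  have one: "1 - l \<notin> periodic_parts l" using assms by (auto simp: periodic_parts_def)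
  have "?P = fps_X ^ l * ?P + fps_X"
  proof (rule fps_ext)
    fix p
    show "?P $ p = (fps_X ^ l * ?P + fps_X) $ p"
      using mem[of p] one by (auto simp: parts_fps_def fps_X_power_mult_nth)
  qed
  then have "?P ^ Suc m = fps_X ^ l * ?P ^ Suc m + fps_X * ?P ^ m"
    by (metis (no_types, lifting) distrib_right mult.assoc power_Suc)
  then have "?P ^ Suc m $ j = (fps_X ^ l * ?P ^ Suc m) $ j + (fps_X * ?P ^ m) $ j"
    by (metis fps_add_nth)
  then show ?thesis by (simp add: fps_X_power_mult_nth not_le del: power_Suc)
qed

text \<open>This is the negative binomial expansion of \<open>(X / (1 - X ^ l)) ^ Suc m\<close>,
  obtained from the recursion by Pascal's rule.\<close>

lemma parts_fps_power_nth:
  assumes "0 < l"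
  shows "parts_fps (periodic_parts l) ^ Suc m $ j =
    (if m < j \<and> l dvd j - Suc m then real ((m + (j - Suc m) div l) choose m) else 0)"
proof (induction m arbitrary: j)
  case 0
  have "j \<in> periodic_parts l \<longleftrightarrow> 0 < j \<and> l dvd j - Suc 0"
    by (cases j) (auto simp: periodic_parts_def dvd_def)
  then show ?case by (simp add: parts_fps_def)
next
  case (Suc m)
  note IHm = Suc.IH
  show ?case
  proof (induction j rule: less_induct)
    case (less j)
    let ?P = "parts_fps (periodic_parts l)"
    note rec = parts_fps_power_rec[OF assms, of "Suc m" j]
    show ?case
    proof (cases "Suc m < j")
      case False
      then show ?thesis using rec less[of "j - l"] assms IHm[of "j - 1"]
        by (auto simp del: power_Suc)
    next
      case True
      define r where "r = j - Suc (Suc m)"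
      have j: "j = Suc (Suc m) + r" using True r_def by simp
      show ?thesis
      proof (cases "r < l")
        case True
        then show ?thesis using rec less[of "j - l"] assms IHm[of "j - 1"] j
          by (auto simp del: power_Suc dest: dvd_imp_le)
      next
        case False
        \<comment> \<open>With \<open>q = r div l\<close>, the two terms of the recursion are
          \<open>(m + q) choose Suc m\<close> and \<open>(m + q) choose m\<close> when
          \<open>l\<close> divides \<open>r\<close>, and both vanish otherwise.\<close>
        have "l dvd r - l \<longleftrightarrow> l dvd r" using False by (simp add: dvd_minus_self)
        moreover have "j - l - Suc (Suc m) = r - l" "j - 1 - Suc m = r" using j by auto
        moreover have "r div l = Suc ((r - l) div l)"
          using False assms by (simp add: le_div_geq)
        moreover have "Suc m < j - l" "l \<le> j" "m < j - 1" "j - l < j" using False j assms by auto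
        ultimately show ?thesis using rec less[of "j - l"] IHm[of "j - 1"] True r_def
          by (auto simp del: power_Suc)
      qed
    qed
  qed
qed

section \<open>Dissections as arc systems\<close>

lemma sides_iff:
  assumes "p < q"
  shows "{p, q} \<in> sides C \<longleftrightarrow> p \<in> C \<and> q \<in> C \<and>
    ((\<forall>v\<in>C. \<not> (p < v \<and> v < q)) \<or> (\<forall>v\<in>C. p \<le> v \<and> v \<le> q))"
  using assms by (auto simp: sides_def doubleton_eq_iff)

lemma diagonals_iff:
  assumes "p < q"
  shows "{p, q} \<in> diagonals C \<longleftrightarrow> p \<in> C \<and> q \<in> C \<and>
    (\<exists>v\<in>C. p < v \<and> v < q) \<and> (\<exists>v\<in>C. v < p \<or> q < v)"
proof -
  have "{p, q} \<in> {{a, b} | a b. a \<in> C \<and> b \<in> C \<and> a < b} \<longleftrightarrow> p \<in> C \<and> q \<in> C"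
    using assms by (auto simp: doubleton_eq_iff)
  then show ?thesis
    unfolding diagonals_def Diff_iff sides_iff[OF assms] by (auto simp: not_le)
qed

lemma sidesE:
  assumes "e \<in> sides C"
  obtains p q where "p < q" "e = {p, q}"
  using assms by (auto simp: sides_def)

lemma diagonalsE:
  assumes "e \<in> diagonals C"
  obtains p q where "p < q" "e = {p, q}"
  using assms by (auto simp: diagonals_def)

lemma crossing_iff:
  assumes "a < b" "c < d"
  shows "crossing {a, b} {c, d} \<longleftrightarrow> a < c \<and> c < b \<and> b < d \<or> c < a \<and> a < d \<and> d < b"
proof
  assume "crossing {a, b} {c, d}"
  then obtain a' b' c' d' where "a' < c'" "c' < b'" "b' < d'"
    "{a, b} = {a', b'} \<and> {c, d} = {c', d'} \<or> {a, b} = {c', d'} \<and> {c, d} = {a', b'}"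
    unfolding crossing_def doubleton_eq_iff[of "{a, b}"] by blast
  then show "a < c \<and> c < b \<and> b < d \<or> c < a \<and> a < d \<and> d < b"
    using assms by (auto simp: doubleton_eq_iff)
qed (auto simp: crossing_def)

definition chords :: "nat set set \<Rightarrow> (nat \<times> nat) set" where
  "chords D = {(a, b). a < b \<and> {a, b} \<in> D}"

text \<open>The pair \<open>(0, N)\<close> is removed because it is the side closing the polygon;
  the other sides are unit steps and no arcs.\<close>

lemma chords_diagonals: "chords (diagonals {0..N}) = arcs 0 N - {(0, N)}"
proof -
  have "a < b \<and> {a, b} \<in> diagonals {0..N} \<longleftrightarrow> a + 2 \<le> b \<and> b \<le> N \<and> (a, b) \<noteq> (0, N)" for a b
  proof (cases "a < b")
    case True
    have "(\<exists>v\<in>{0..N}. a < v \<and> v < b) \<longleftrightarrow> a + 2 \<le> b" if "b \<le> N"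
    proof
      assume "a + 2 \<le> b" then show "\<exists>v\<in>{0..N}. a < v \<and> v < b"
        using that by (intro bexI[of _ "a + 1"]) auto
    qed auto
    moreover have "(\<exists>v\<in>{0..N}. v < a \<or> b < v) \<longleftrightarrow> (a, b) \<noteq> (0, N)" if "b \<le> N"
      using that by (auto intro: bexI[of _ 0] bexI[of _ N])
    ultimately show ?thesis using True by (auto simp: diagonals_iff)
  qed auto
  then show ?thesis by (auto simp: chords_def arcs_def)
qed

lemma chords_inj:
  assumes "D \<subseteq> diagonals V" "E \<subseteq> diagonals V" "chords D = chords E"
  shows "D = E"
proof -
  have "D \<subseteq> E" if "D \<subseteq> diagonals V" "chords D = chords E" for D E
  proof
    fix e assume e: "e \<in> D"
    with that(1) have "e \<in> diagonals V" by blast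
    then obtain p q where pq: "p < q" "e = {p, q}" by (rule diagonalsE)
    then have "(p, q) \<in> chords D" using e by (simp add: chords_def)
    then have "(p, q) \<in> chords E" using that(2) by simp
    then show "e \<in> E" using pq by (simp add: chords_def)
  qed
  then show ?thesis using assms by blast
qed

lemma dissection_iff_noncrossing:
  assumes "D \<subseteq> diagonals V"
  shows "dissection V D \<longleftrightarrow> noncrossing (chords D)"
proof
  assume D: "dissection V D"
  show "noncrossing (chords D)"
    unfolding noncrossing_def
  proof (intro allI impI notI)
    fix a b c d assume "(a, b) \<in> chords D" "(c, d) \<in> chords D" "a < c \<and> c < b \<and> b < d"
    then have "{a, b} \<in> D" "{c, d} \<in> D" "crossing {a, b} {c, d}"
      by (auto simp: chords_def crossing_iff)
    then show False using D by (simp add: dissection_def)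
  qed
next
  assume nc: "noncrossing (chords D)"
  have "\<not> crossing e f" if "e \<in> D" "f \<in> D" for e f
  proof
    assume cr: "crossing e f"
    have ef: "e \<in> diagonals V" "f \<in> diagonals V" using that assms by auto
    obtain a b where "a < b" "e = {a, b}" using ef(1) by (rule diagonalsE)
    moreover obtain c d where "c < d" "f = {c, d}" using ef(2) by (rule diagonalsE)
    ultimately have "(a, b) \<in> chords D" "(c, d) \<in> chords D"
      "a < c \<and> c < b \<and> b < d \<or> c < a \<and> a < d \<and> d < b"
      using that cr by (simp_all add: chords_def crossing_iff)
    then show False using nc unfolding noncrossing_def by blast
  qed
  then show "dissection V D" using assms by (simp add: dissection_def)
qed

lemma chords_image:
  assumes "A \<subseteq> {(a, b). a < b}"
  shows "chords ((\<lambda>(a, b). {a, b}) ` A) = A"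
proof -
  have "{a, b} \<in> (\<lambda>(a, b). {a, b}) ` A \<longleftrightarrow> (a, b) \<in> A" if "a < b" for a b
    using assms that by (auto simp: image_iff doubleton_eq_iff)
  then have "chords ((\<lambda>(a, b). {a, b}) ` A) = {(a, b). a < b \<and> (a, b) \<in> A}"
    by (simp add: chords_def cong: conj_cong)
  then show ?thesis using assms by auto
qed

text \<open>A side of the polygon is a unit step or \<open>(0, N)\<close>. Putting
  \<open>(0, N)\<close> into \<open>A\<close> lets one set stand for both the diagonals and the
  closing side.\<close>

lemma cells_iff:
  assumes D: "D \<subseteq> diagonals {0..N}" and N: "2 \<le> N" and A: "A = insert (0, N) (chords D)"
  shows "C \<in> cells {0..N} D \<longleftrightarrow> C \<subseteq> {0..N} \<and> 3 \<le> card C \<and>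
    (\<forall>p\<in>C. \<forall>q\<in>C. p < q \<and> ((\<forall>v\<in>C. \<not> (p < v \<and> v < q)) \<or> (\<forall>v\<in>C. p \<le> v \<and> v \<le> q)) \<longrightarrow>
       q = p + 1 \<or> (p, q) \<in> A) \<and>
    (\<forall>p\<in>C. \<forall>q\<in>C. \<forall>v\<in>C. \<forall>w\<in>C. p < v \<and> v < q \<and> (w < p \<or> q < w) \<longrightarrow> (p, q) \<notin> A)"
proof -
  have D_iff: "{p, q} \<in> D \<longleftrightarrow> (p, q) \<in> chords D" if "p < q" for p q
    using that by (simp add: chords_def)
  have side: "{p, q} \<in> sides {0..N} \<longleftrightarrow> q = p + 1 \<or> (p, q) = (0, N)" if "p < q" "q \<le> N" for p q
  proof -
    have "(\<forall>v\<in>{0..N}. \<not> (p < v \<and> v < q)) \<longleftrightarrow> q = p + 1"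
    proof
      assume "\<forall>v\<in>{0..N}. \<not> (p < v \<and> v < q)"
      from this[rule_format, of "p + 1"] show "q = p + 1" using that by auto
    qed auto
    moreover have "(\<forall>v\<in>{0..N}. p \<le> v \<and> v \<le> q) \<longleftrightarrow> (p, q) = (0, N)"
    proof
      assume "\<forall>v\<in>{0..N}. p \<le> v \<and> v \<le> q"
      then have "p \<le> 0" "N \<le> q" by auto
      then show "(p, q) = (0, N)" using that by simp
    qed auto
    ultimately show ?thesis using that by (simp add: sides_iff)
  qed
  have sides: "sides C \<subseteq> sides {0..N} \<union> D \<longleftrightarrow>
    (\<forall>p\<in>C. \<forall>q\<in>C. p < q \<and> ((\<forall>v\<in>C. \<not> (p < v \<and> v < q)) \<or> (\<forall>v\<in>C. p \<le> v \<and> v \<le> q)) \<longrightarrow>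
       q = p + 1 \<or> (p, q) \<in> A)" (is "?L \<longleftrightarrow> ?R") if C: "C \<subseteq> {0..N}"
  proof -
    have "?L \<longleftrightarrow> (\<forall>p q. p < q \<longrightarrow> {p, q} \<in> sides C \<longrightarrow> {p, q} \<in> sides {0..N} \<union> D)"
      by (blast elim: sidesE)
    also have "\<dots> \<longleftrightarrow> (\<forall>p q. p < q \<longrightarrow> {p, q} \<in> sides C \<longrightarrow> q = p + 1 \<or> (p, q) \<in> A)"
    proof -
      have "{p, q} \<in> sides {0..N} \<union> D \<longleftrightarrow> q = p + 1 \<or> (p, q) \<in> A"
        if "p < q" "{p, q} \<in> sides C" for p q
      proof -
        have "q \<le> N" using that C by (auto simp: sides_iff)
        then show ?thesis using side[OF that(1)] D_iff[OF that(1)] A by auto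
      qed
      then show ?thesis by blast
    qed
    also have "\<dots> \<longleftrightarrow> ?R" by (auto simp: sides_iff)
    finally show ?thesis .
  qed
  have diagonals: "diagonals C \<inter> D = {} \<longleftrightarrow>
    (\<forall>p\<in>C. \<forall>q\<in>C. \<forall>v\<in>C. \<forall>w\<in>C. p < v \<and> v < q \<and> (w < p \<or> q < w) \<longrightarrow> (p, q) \<notin> A)"
    (is "?L \<longleftrightarrow> ?R") if C: "C \<subseteq> {0..N}"
  proof -
    have "?L \<longleftrightarrow> (\<forall>p q. p < q \<longrightarrow> {p, q} \<in> diagonals C \<longrightarrow> {p, q} \<notin> D)"
      by (blast elim: diagonalsE)
    also have "\<dots> \<longleftrightarrow> (\<forall>p q. p < q \<longrightarrow> {p, q} \<in> diagonals C \<longrightarrow> (p, q) \<notin> A)"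
    proof -
      have "{p, q} \<in> D \<longleftrightarrow> (p, q) \<in> A" if "p < q" "{p, q} \<in> diagonals C" for p q
      proof -
        \<comment> \<open>A diagonal of \<open>C\<close> has a vertex of \<open>C\<close> outside
          its span, and nothing lies outside \<open>(0, N)\<close>.\<close>
        have "(p, q) \<noteq> (0, N)" using that C by (fastforce simp: diagonals_iff)
        then show ?thesis using D_iff[OF that(1)] A by auto
      qed
      then show ?thesis by blast
    qed
    also have "\<dots> \<longleftrightarrow> ?R"
      by (auto simp: diagonals_iff) (metis order.strict_trans)+
    finally show ?thesis .
  qed
  show ?thesis
  proof (cases "C \<subseteq> {0..N}")
    case True
    show ?thesis unfolding cells_def mem_Collect_eq sides[OF True] diagonals[OF True] ..
  qed (simp add: cells_def)
qed

section \<open>Cells of a dissection as faces of arcs\<close>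

lemma face_endpoints:
  assumes "A \<subseteq> arcs s N" "(a, b) \<in> A"
  shows "a \<in> face A a b" "b \<in> face A a b" "face A a b \<subseteq> {a..b}"
proof -
  have "a \<le> b" using assms by (auto simp: arcs_def)
  then show "a \<in> face A a b" "b \<in> face A a b"
    unfolding face_def using endpoints_visible[OF inside_subset_arcs[OF assms(1)]] by auto
  show "face A a b \<subseteq> {a..b}" by (auto simp: face_def visible_def)
qed

lemma consecutive_face:
  assumes "A \<subseteq> arcs s N" "noncrossing A" "p \<in> face A a b" "q \<in> face A a b" "p < q"
    "\<And>v. v \<in> face A a b \<Longrightarrow> \<not> (p < v \<and> v < q)"
  shows "q = p + 1 \<or> (p, q) \<in> inside A a b"
  by (rule consecutive_visible[OF inside_subset_arcs[OF assms(1)] noncrossing_inside[OF assms(2)]])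
    (use assms(3-6) in \<open>unfold face_def\<close>)

text \<open>If \<open>a\<close> and \<open>b\<close> were consecutive on the face, then
  \<open>b = a + 1\<close> or \<open>(a, b)\<close> would lie inside itself.\<close>

lemma card_face_ge:
  assumes "A \<subseteq> arcs s N" "noncrossing A" "(a, b) \<in> A"
  shows "3 \<le> card (face A a b)"
proof -
  note e = face_endpoints[OF assms(1,3)]
  have ab: "a + 2 \<le> b" using assms by (auto simp: arcs_def)
  have "(a, b) \<notin> inside A a b" by (simp add: inside_def)
  then obtain v where v: "v \<in> face A a b" "a < v" "v < b"
    using consecutive_face[OF assms(1,2) e(1,2)] ab by fastforce
  have "card {a, v, b} \<le> card (face A a b)"
    by (rule card_mono) (use e v in \<open>auto simp: face_def\<close>)
  then show ?thesis using v by simp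
qed

lemma face_inj:
  assumes "A \<subseteq> arcs s N"
  shows "inj_on (\<lambda>(a, b). face A a b) A"
proof (rule inj_onI, clarify)
  fix a b c d assume "(a, b) \<in> A" "(c, d) \<in> A" "face A a b = face A c d"
  then have "a \<in> {c..d}" "b \<in> {c..d}" "c \<in> {a..b}" "d \<in> {a..b}"
    using face_endpoints[OF assms] by (metis subsetD)+
  then show "a = c \<and> b = d" by simp
qed

lemma bracket_in_finite_set:
  fixes C :: "nat set"
  assumes "finite C" "a \<in> C" "b \<in> C" "a < x" "x < b" "x \<notin> C"
  obtains p q where "p \<in> C" "q \<in> C" "p < x" "x < q"
    "\<And>v. v \<in> C \<Longrightarrow> v < x \<Longrightarrow> v \<le> p" "\<And>v. v \<in> C \<Longrightarrow> x < v \<Longrightarrow> q \<le> v"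
proof -
  let ?L = "{c \<in> C. c < x}" and ?U = "{c \<in> C. x < c}"
  have "Max ?L \<in> ?L" by (rule Max_in) (use assms in auto)
  moreover have "Min ?U \<in> ?U" by (rule Min_in) (use assms in auto)
  ultimately show thesis using that[of "Max ?L" "Min ?U"] assms by auto
qed

text \<open>Consecutive vertices of a face are joined by unit steps or arcs, and an arc cutting the
  face would hide one of its vertices. Conversely, a cell is the face of the arc from its least to
  its greatest vertex.\<close>

lemma cells_eq_faces:
  assumes D: "D \<subseteq> diagonals {0..N}" and N: "2 \<le> N" and A: "A = insert (0, N) (chords D)"
    and nc: "noncrossing A"
  shows "cells {0..N} D = (\<lambda>(a, b). face A a b) ` A"
proof (intro equalityI subsetI)
  have sub: "A \<subseteq> arcs 0 N"
    using chords_diagonals[of N] D N A by (auto simp: chords_def arcs_def)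
  note cells = cells_iff[OF D N A]
  {
    fix C assume "C \<in> (\<lambda>(a, b). face A a b) ` A"
    then obtain a b where ab: "(a, b) \<in> A" and C: "C = face A a b" by auto
    note e = face_endpoints[OF sub ab, folded C]
    have bN: "b \<le> N" using sub ab by (auto simp: arcs_def)
    show "C \<in> cells {0..N} D"
      unfolding cells
    proof (intro conjI ballI impI)
      show "C \<subseteq> {0..N}" using e(3) bN by auto
      show "3 \<le> card C" using card_face_ge[OF sub nc ab] C by simp
    next
      fix p q assume p: "p \<in> C" and q: "q \<in> C"
        and pq: "p < q \<and> ((\<forall>v\<in>C. \<not> (p < v \<and> v < q)) \<or> (\<forall>v\<in>C. p \<le> v \<and> v \<le> q))"
      then consider "\<forall>v\<in>C. \<not> (p < v \<and> v < q)" | "\<forall>v\<in>C. p \<le> v \<and> v \<le> q" by blast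
      then show "q = p + 1 \<or> (p, q) \<in> A"
      proof cases
        case 1
        then have "q = p + 1 \<or> (p, q) \<in> inside A a b"
          using consecutive_face[OF sub nc, of p a b q] p q pq C by blast
        then show ?thesis by (auto simp: inside_def)
      next
        case 2
        then have "p \<le> a" "b \<le> q" using e by auto
        moreover have "a \<le> p" "q \<le> b" using p q e(3) by auto
        ultimately show ?thesis using ab by simp
      qed
    next
      fix p q v w assume pqvw: "p \<in> C" "q \<in> C" "v \<in> C" "w \<in> C" "p < v \<and> v < q \<and> (w < p \<or> q < w)"
      show "(p, q) \<notin> A"
      proof
        assume "(p, q) \<in> A"
        \<comment> \<open>As \<open>w\<close> lies in \<open>{a..b}\<close> but outside
          \<open>(p, q)\<close>, this arc is not the base; so it is an inside arc and hides
          \<open>v\<close>.\<close>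
        moreover have "a \<le> p" "q \<le> b" "a \<le> w" "w \<le> b" using pqvw e(3) by auto
        ultimately have "(p, q) \<in> inside A a b" using pqvw(5) by (auto simp: inside_def)
        then show False using pqvw(3,5) C by (auto simp: face_def visible_def)
      qed
    qed
  }
  fix C assume "C \<in> cells {0..N} D"
  then have CN: "C \<subseteq> {0..N}" and card: "3 \<le> card C"
    and side: "\<And>p q. p \<in> C \<Longrightarrow> q \<in> C \<Longrightarrow> p < q \<Longrightarrow>
      (\<forall>v\<in>C. \<not> (p < v \<and> v < q)) \<or> (\<forall>v\<in>C. p \<le> v \<and> v \<le> q) \<Longrightarrow> q = p + 1 \<or> (p, q) \<in> A"
    and diag: "\<And>p q v w. p \<in> C \<Longrightarrow> q \<in> C \<Longrightarrow> v \<in> C \<Longrightarrow> w \<in> C \<Longrightarrow>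
      p < v \<Longrightarrow> v < q \<Longrightarrow> w < p \<or> q < w \<Longrightarrow> (p, q) \<notin> A"
    unfolding cells by blast+
  have fin: "finite C" and ne: "C \<noteq> {}" using card by (auto intro: card_ge_0_finite)
  define a b where "a = Min C" and "b = Max C"
  have a: "a \<in> C" and b: "b \<in> C" and rng: "\<And>v. v \<in> C \<Longrightarrow> a \<le> v \<and> v \<le> b"
    using fin ne by (auto simp: a_def b_def)
  obtain v0 where v0: "v0 \<in> C" "a < v0" "v0 < b"
  proof -
    have "\<not> C \<subseteq> {a, b}"
    proof
      assume "C \<subseteq> {a, b}"
      then have "card C \<le> card {a, b}" by (simp add: card_mono)
      also have "\<dots> \<le> 2" by (simp add: card_insert_if)
      finally show False using card by simp
    qed
    then obtain v where "v \<in> C" "v \<noteq> a" "v \<noteq> b" by auto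
    then show thesis using that[of v] rng[of v] by simp
  qed
  \<comment> \<open>The closing side of \<open>C\<close> joins its extreme vertices, and
    \<open>v0\<close> between them rules out a unit step.\<close>
  have ab: "(a, b) \<in> A" using side[OF a b] v0 rng by fastforce
  \<comment> \<open>A vertex \<open>x\<close> missing from \<open>C\<close> lies in a gap of
    \<open>C\<close>. The side of \<open>C\<close> over this gap is no unit step, so it is an arc,
    and \<open>v0\<close> distinguishes it from the base.\<close>
  have cons: "(p, q) \<in> A \<and> (p, q) \<noteq> (a, b) \<and> a \<le> p \<and> q \<le> b"
    if "p \<in> C" "q \<in> C" "p < x" "x < q" "\<And>v. v \<in> C \<Longrightarrow> v < x \<Longrightarrow> v \<le> p"
      "\<And>v. v \<in> C \<Longrightarrow> x < v \<Longrightarrow> q \<le> v" "x \<notin> C" for p q x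
  proof -
    have gap: "\<forall>v\<in>C. \<not> (p < v \<and> v < q)"
      using that by (metis linorder_neqE_nat not_le)
    then have "q = p + 1 \<or> (p, q) \<in> A" using side[of p q] that by simp
    moreover have "(p, q) \<noteq> (a, b)" using gap v0 by auto
    ultimately show ?thesis using that rng by auto
  qed
  have "C = face A a b"
  proof (intro equalityI subsetI)
    fix v assume v: "v \<in> C"
    show "v \<in> face A a b"
      unfolding face_def visible_def
    proof (intro CollectI conjI allI impI notI)
      show "v \<in> {a..b}" using rng[OF v] by simp
      fix c d assume "(c, d) \<in> inside A a b" and cvd: "c < v \<and> v < d"
      then have cd: "(c, d) \<in> A" "a \<le> c" "d \<le> b" "(c, d) \<noteq> (a, b)" by (auto simp: inside_def)
      have "c \<in> C"
      proof (rule ccontr)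
        assume "c \<notin> C"
        then have "a < c" "c < b" using cd a cvd by (auto simp: le_less)
        \<comment> \<open>The arc over the gap around \<open>c\<close> ends at or before
          \<open>v\<close>, so it crosses \<open>(c, d)\<close>.\<close>
        from bracket_in_finite_set[OF fin a b this \<open>c \<notin> C\<close>] obtain p q where
          pq: "p \<in> C" "q \<in> C" "p < c" "c < q" "\<And>v. v \<in> C \<Longrightarrow> v < c \<Longrightarrow> v \<le> p"
            "\<And>v. v \<in> C \<Longrightarrow> c < v \<Longrightarrow> q \<le> v" by metis
        have "(p, q) \<in> A" using cons[OF pq \<open>c \<notin> C\<close>] by simp
        moreover have "q < d" using pq(6)[OF v] cvd by simp
        ultimately show False using nc cd(1) pq(3,4) unfolding noncrossing_def by blast
      qed
      moreover have "d \<in> C"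
      proof (rule ccontr)
        assume "d \<notin> C"
        then have "a < d" "d < b" using cd b cvd by (auto simp: le_less)
        from bracket_in_finite_set[OF fin a b this \<open>d \<notin> C\<close>] obtain p q where
          pq: "p \<in> C" "q \<in> C" "p < d" "d < q" "\<And>v. v \<in> C \<Longrightarrow> v < d \<Longrightarrow> v \<le> p"
            "\<And>v. v \<in> C \<Longrightarrow> d < v \<Longrightarrow> q \<le> v" by metis
        have "(p, q) \<in> A" using cons[OF pq \<open>d \<notin> C\<close>] by simp
        moreover have "c < p" using pq(5)[OF v] cvd by simp
        ultimately show False using nc cd(1) pq(3,4) unfolding noncrossing_def by blast
      qed
      moreover have "a < c \<or> d < b" using cd by auto
      \<comment> \<open>With both ends in \<open>C\<close>, \<open>(c, d)\<close> is a diagonal of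
        \<open>C\<close>: \<open>v\<close> is on one side and \<open>a\<close> or \<open>b\<close>
        on the other.\<close>
      ultimately show False using diag[of c d v a] diag[of c d v b] v cvd a b cd(1) by blast
    qed
  next
    fix x assume x: "x \<in> face A a b"
    show "x \<in> C"
    proof (rule ccontr)
      assume "x \<notin> C"
      have "a \<le> x" "x \<le> b" using x by (auto simp: face_def visible_def)
      moreover have "x \<noteq> a" "x \<noteq> b" using a b \<open>x \<notin> C\<close> by auto
      ultimately have "a < x" "x < b" by auto
      from bracket_in_finite_set[OF fin a b this \<open>x \<notin> C\<close>] obtain p q where
        pq: "p \<in> C" "q \<in> C" "p < x" "x < q" "\<And>v. v \<in> C \<Longrightarrow> v < x \<Longrightarrow> v \<le> p"
          "\<And>v. v \<in> C \<Longrightarrow> x < v \<Longrightarrow> q \<le> v" by metis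
      \<comment> \<open>The arc over the gap hides \<open>x\<close>, which was taken from the
        face.\<close>
      have "(p, q) \<in> inside A a b" using cons[OF pq \<open>x \<notin> C\<close>] by (simp add: inside_def)
      then show False using x pq(3,4) by (auto simp: face_def visible_def)
    qed
  qed
  then show "C \<in> (\<lambda>(a, b). face A a b) ` A" using ab by auto
qed

section \<open>The bijection with dissections and the final formula\<close>

lemma visible_with_root:
  assumes "A \<subseteq> arcs 0 N" "(0, N) \<in> A"
  shows "visible A 0 N = {0, N}"
proof -
  have "visible A 0 N \<subseteq> {0, N}" using assms(2) by (fastforce simp: visible_def)
  then show ?thesis using endpoints_visible[OF assms(1)] by auto
qed

text \<open>Only the two endpoints are visible, so they are consecutive, and
  \<open>2 \<le> N\<close> excludes a unit step.\<close>

lemma root_in_systems_1: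
  assumes "A \<in> systems S 0 N 1 m" "2 \<le> N"
  shows "(0, N) \<in> A"
proof -
  note mA = systems_memD[OF assms(1)]
  have e: "0 \<in> visible A 0 N" "N \<in> visible A 0 N" using endpoints_visible[OF mA(1)] by auto
  have "visible A 0 N = {0, N}"
    by (rule card_subset_eq[symmetric]) (use e mA(4) assms(2) in auto)
  then have "\<not> (0 < v \<and> v < N)" if "v \<in> visible A 0 N" for v using that by auto
  from consecutive_visible[OF mA(1,2) e _ this] show ?thesis using assms(2) by auto
qed

text \<open>Adding the base \<open>(0, N)\<close> to the diagonals gives a single tree, hence
  \<open>k = 1\<close>, with one arc per cell. The cell size \<open>3 + l * d\<close> is
  \<open>p + 2\<close> for \<open>p = 1 + l * d\<close>.\<close>

lemma num_periodic_dissections_eq_card_systems: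
  assumes "0 < n"
  shows "num_periodic_dissections l n m = card (systems (periodic_parts l) 0 (n + 1) 1 m)"
proof -
  define N where "N = n + 1"
  have N: "2 \<le> N" "{0..<n + 2} = {0..N}" using assms by (auto simp: N_def)
  let ?S = "periodic_parts l"
  let ?X = "{D. periodic_dissection l {0..N} D \<and> card (cells {0..N} D) = m}"
  let ?f = "\<lambda>D. insert (0, N) (chords D)"
  have chords: "chords D \<subseteq> arcs 0 N - {(0, N)}" if "D \<subseteq> diagonals {0..N}" for D
    using that chords_diagonals[of N] by (auto simp: chords_def)
  have nc_iff: "noncrossing (?f D) \<longleftrightarrow> dissection {0..N} D" if D: "D \<subseteq> diagonals {0..N}" for D
  proof -
    have "noncrossing (?f D)" if "noncrossing (chords D)"
      by (rule noncrossing_insert[where N = N])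
        (use that chords[OF D] endpoints_visible(2)[of "chords D" 0 N] in auto)
    then show ?thesis
      using dissection_iff_noncrossing[OF D] noncrossing_subset[of "?f D" "chords D"] by blast
  qed
  have size_iff: "(\<exists>d. c = 3 + l * d) \<longleftrightarrow> (\<exists>p\<in>?S. c = p + 2)" for c
    by (auto simp: periodic_parts_def)
  have iff: "?f D \<in> systems ?S 0 N 1 m \<longleftrightarrow> D \<in> ?X" if D: "D \<subseteq> diagonals {0..N}" for D
  proof (cases "dissection {0..N} D")
    case True
    then have nc: "noncrossing (?f D)" using nc_iff[OF D] by simp
    have sub: "?f D \<subseteq> arcs 0 N" using chords[OF D] N by (auto simp: arcs_def)
    note cells = cells_eq_faces[OF D N(1) refl nc]
    have "card (cells {0..N} D) = card (?f D)"
      unfolding cells by (rule card_image[OF face_inj[OF sub]])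
    moreover have "card (visible (?f D) 0 N) = 1 + 1"
      using visible_with_root[OF sub] N by simp
    ultimately show ?thesis
      using True nc sub
      unfolding systems_def mem_Collect_eq periodic_dissection_def cells size_iff by auto
  next
    case False
    then show ?thesis using nc_iff[OF D] by (simp add: systems_def periodic_dissection_def)
  qed
  have sub_diag: "D \<subseteq> diagonals {0..N}" if "D \<in> ?X" for D
    using that by (simp add: periodic_dissection_def dissection_def)
  have "bij_betw ?f ?X (systems ?S 0 N 1 m)"
    unfolding bij_betw_def
  proof
    show "inj_on ?f ?X"
    proof (rule inj_onI)
      fix D E assume DE: "D \<in> ?X" "E \<in> ?X" "?f D = ?f E"
      have "(0, N) \<notin> chords D" "(0, N) \<notin> chords E"
        using chords[OF sub_diag[OF DE(1)]] chords[OF sub_diag[OF DE(2)]] by auto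
      then have "chords D = chords E" using DE(3) by (metis insert_ident)
      then show "D = E" using chords_inj sub_diag DE(1,2) by metis
    qed
    show "?f ` ?X = systems ?S 0 N 1 m"
    proof (intro equalityI subsetI)
      fix A assume "A \<in> ?f ` ?X"
      then show "A \<in> systems ?S 0 N 1 m" using iff sub_diag by blast
    next
      fix A assume A: "A \<in> systems ?S 0 N 1 m"
      define B where "B = A - {(0, N)}"
      define D where "D = (\<lambda>(a, b). {a, b}) ` B"
      have B: "B \<subseteq> arcs 0 N - {(0, N)}" using systems_memD(1)[OF A] by (auto simp: B_def)
      then have "chords D = B" unfolding D_def by (intro chords_image) (auto simp: arcs_def)
      then have fD: "?f D = A" using root_in_systems_1[OF A N(1)] by (auto simp: B_def)
      have "D \<subseteq> diagonals {0..N}"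
        using B unfolding chords_diagonals[symmetric] by (auto simp: D_def chords_def)
      then have "D \<in> ?X" using iff[of D] A fD by simp
      then show "A \<in> ?f ` ?X" using fD by blast
    qed
  qed
  then show ?thesis
    unfolding num_periodic_dissections_def N(2) N_def[symmetric] by (rule bij_betw_same_card)
qed

theorem theorem3p9:
  fixes l n m :: nat
  assumes "0 < l" and "0 < m" and "m \<le> n"
  shows "(\<not> [m = n] (mod l) \<longrightarrow> num_periodic_dissections l n m = 0) \<and>
         ([m = n] (mod l) \<longrightarrow>
            real (num_periodic_dissections l n m) =
              1 / (real n + 1) * real ((m - 1 + (n - m) div l) choose (m - 1))
                * real ((n + m) choose m))"
proof -
  obtain m' where m': "m = Suc m'" using assms(2) gr0_implies_Suc by blast
  define x where "x = real (num_periodic_dissections l n m)"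
  define W where "W = parts_fps (periodic_parts l) ^ m $ n"
  have "0 \<notin> periodic_parts l" by (simp add: periodic_parts_def)
  \<comment> \<open>An \<open>(n + 2)\<close>-gon has \<open>n + 1\<close> sides besides its base,
    so there are \<open>n + 1\<close> leaves in one tree and the coefficient index is
    \<open>n\<close>.\<close>
  from card_systems[OF this, of 0 "n + 1" "n + 1" 1 m]
  have main: "real (n + 1 + m) * x = real ((n + 1 + m) choose m) * W"
    using assms by (simp add: num_periodic_dissections_eq_card_systems x_def W_def)
  have cong: "[m = n] (mod l) \<longleftrightarrow> l dvd n - m"
    using assms(3) by (metis cong_altdef_nat cong_sym_eq)
  have W: "W = (if l dvd n - m then real ((m - 1 + (n - m) div l) choose (m - 1)) else 0)"
    unfolding W_def m' parts_fps_power_nth[OF assms(1)] using assms(3) m' by simp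
  \<comment> \<open>Absorption trades the factor \<open>n + 1 + m\<close> for \<open>n + 1\<close>,
    the denominator of the claim.\<close>
  have "real (n + 1) * ((n + 1 + m) choose m) = real (n + 1 + m) * ((n + m) choose m)"
    using binomial_absorb_real(2)[of "n + 1" m'] by (simp add: m' algebra_simps)
  then have "real (n + 1 + m) * (real (n + 1) * x) = real (n + 1 + m) * (real ((n + m) choose m) * W)"
    using main by (metis mult.assoc mult.left_commute)
  then have "real (n + 1) * x = real ((n + m) choose m) * W" by simp
  then have "x = 1 / (real n + 1) * W * real ((n + m) choose m)"
    by (simp add: field_simps)
  then show ?thesis using W cong by (auto simp: x_def)
qed

end
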